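(* Let $\alpha,\beta,\gamma\in\mathbb{R}$. Let $G_3$ be the connected, simply connected three-dimensional Lie group with left-invariant Lorentzian metric $g$ whose Lie algebra has a pseudo-orthonormal basis $\{e_1,e_2,e_3\}$, $e_3$ timelike, with $$[e_1,e_2]=-\gamma e_3,\quad [e_1,e_3]=-\beta e_2,\quad [e_2,e_3]=\alpha e_1.$$ Let $V=\lambda_1e_1+\lambda_2e_2+\lambda_3e_3$ with $\lambda_1,\lambda_2,\lambda_3\in\mathbb{R}$, and let $\lambda\in\mathbb{R}$. Then $(G_3,V,g)$ is a left-invariant Riemann soliton with constant $\lambda$ if and only if one of the following holds (parameters not mentioned in a case are unrestricted): (i) $\beta=\gamma$, $\alpha\neq\gamma$, $\lambda_2=\lambda_3=0$, $\alpha=0$, $\lambda=0$; (ii) $\alpha=\beta=\gamma$, $\lambda=\frac14\alpha^2$; (iii) $\beta\neq\gamma$, $\alpha=\beta$, $\lambda_1=\lambda_2=0$, $\gamma=0$, $\lambda=0$; (iv) $\beta\neq\gamma$, $\alpha=\gamma$, $\lambda_1=\lambda_3=0$, $\beta=0$, $\lambda=0$.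
   Context: Elements of the Lie algebra are identified with left-invariant vector fields. A pseudo-orthonormal basis $\{e_1,e_2,e_3\}$ with $e_3$ timelike means $g(e_1,e_1)=g(e_2,e_2)=1$, $g(e_3,e_3)=-1$, and $g(e_i,e_j)=0$ for $i\ne j$. Let $\nabla$ be the Levi-Civita connection of $g$, with curvature $R(X,Y)Z=\nabla_X\nabla_YZ-\nabla_Y\nabla_XZ-\nabla_{[X,Y]}Z$, and set $R(X,Y,Z,W)=-g(R(X,Y)Z,W)$. For $(0,2)$-tensors $T_1,T_2$ the Kulkarni-Nomizu product is $$(T_1\wedge T_2)(X,Y,Z,W)=T_1(X,W)T_2(Y,Z)+T_1(Y,Z)T_2(X,W)-T_1(X,Z)T_2(Y,W)-T_1(Y,W)T_2(X,Z).$$ $L_Vg$ denotes the Lie derivative of $g$ along $V$. For a left-invariant vector field $V$ and a real constant $\lambda$, $(G,V,g)$ is a left-invariant Riemann soliton with constant $\lambda$ if $R+\frac12 L_Vg\wedge g=\frac{\lambda}{2}g\wedge g$, i.e. for all vector fields $X,Y,Z,W$, $$2R(X,Y,Z,W)+g(X,W)(L_Vg)(Y,Z)+g(Y,Z)(L_Vg)(X,W)-g(X,Z)(L_Vg)(Y,W)-g(Y,W)(L_Vg)(X,Z)=2\lambda[g(X,W)g(Y,Z)-g(X,Z)g(Y,W)].$$ *)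

theory Defs
  imports "HOL-Analysis.Analysis" "HOL-Algebra.Group" "HOL-Library.Function_Algebras"
begin

text \<open>Sums, differences and products of functions are taken pointwise (Function_Algebras).\<close>

primrec Ck_on ::
  "nat \<Rightarrow> 'a::euclidean_space set \<Rightarrow> ('a \<Rightarrow> 'b::real_normed_vector) \<Rightarrow> bool" where
  "Ck_on 0 S f \<longleftrightarrow> continuous_on S f"
| "Ck_on (Suc k) S f \<longleftrightarrow>
     (\<forall>x\<in>S. f differentiable (at x)) \<and>
     (\<forall>v. Ck_on k S (\<lambda>x. frechet_derivative f (at x) v))"

definition smooth_on ::
  "'a::euclidean_space set \<Rightarrow> ('a \<Rightarrow> 'b::real_normed_vector) \<Rightarrow> bool" where
  "smooth_on S f \<longleftrightarrow> open S \<and> (\<forall>k. Ck_on k S f)"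

text \<open>A chart is a pair of its domain and its coordinate map; only the values of the
  coordinate map on the domain matter.\<close>

type_synonym ('m, 'e) chart = "'m set \<times> ('m \<Rightarrow> 'e)"

definition is_chart :: "('m::topological_space, 'e::euclidean_space) chart \<Rightarrow> bool" where
  "is_chart c \<longleftrightarrow> (case c of (U, \<phi>) \<Rightarrow>
     open U \<and> open (\<phi> ` U) \<and> homeomorphism U (\<phi> ` U) \<phi> (inv_into U \<phi>))"

definition smooth_atlas :: "('m::topological_space, 'e::euclidean_space) chart set \<Rightarrow> bool" where
  "smooth_atlas \<A> \<longleftrightarrow>
     (\<forall>c\<in>\<A>. is_chart c) \<and> (\<Union>(U, \<phi>)\<in>\<A>. U) = UNIV \<and>
     (\<forall>(U, \<phi>)\<in>\<A>. \<forall>(V, \<psi>)\<in>\<A>. smooth_on (\<phi> ` (U \<inter> V)) (\<psi> \<circ> inv_into U \<phi>))"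

definition smooth_map ::
  "('m::topological_space, 'e::euclidean_space) chart set \<Rightarrow>
   ('n::topological_space, 'f::euclidean_space) chart set \<Rightarrow> ('m \<Rightarrow> 'n) \<Rightarrow> bool" where
  "smooth_map \<A> \<B> F \<longleftrightarrow> continuous_on UNIV F \<and>
     (\<forall>(U, \<phi>)\<in>\<A>. \<forall>(V, \<psi>)\<in>\<B>.
        smooth_on (\<phi> ` (U \<inter> F -` V)) (\<psi> \<circ> F \<circ> inv_into U \<phi>))"

definition prod_atlas ::
  "('m, 'e) chart set \<Rightarrow> ('n, 'f) chart set \<Rightarrow> ('m \<times> 'n, 'e \<times> 'f) chart set" where
  "prod_atlas \<A> \<B> = {(U \<times> V, map_prod \<phi> \<psi>) | U \<phi> V \<psi>. (U, \<phi>) \<in> \<A> \<and> (V, \<psi>) \<in> \<B>}"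

definition smooth_functions ::
  "('m::topological_space, 'e::euclidean_space) chart set \<Rightarrow> ('m \<Rightarrow> real) set" where
  "smooth_functions \<A> = {f. smooth_map \<A> {(UNIV, id)} f}"

text \<open>Tangent vectors act on smooth functions as directional derivatives in a chart. Since
  HOL functions are total, their value on non-smooth functions is fixed to be 0, so that two
  tangent vectors are equal iff they agree on all smooth functions. A vector field is
  represented by its action on functions.\<close>

type_synonym 'm tvec = "('m \<Rightarrow> real) \<Rightarrow> real"
type_synonym 'm vfield = "('m \<Rightarrow> real) \<Rightarrow> ('m \<Rightarrow> real)"

definition tangent_space ::
  "('m::topological_space, 'e::euclidean_space) chart set \<Rightarrow> 'm \<Rightarrow> 'm tvec set" where
  "tangent_space \<A> p =
     {(\<lambda>f. if f \<in> smooth_functions \<A>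
            then frechet_derivative (f \<circ> inv_into U \<phi>) (at (\<phi> p)) w else 0)
      | U \<phi> w. (U, \<phi>) \<in> \<A> \<and> p \<in> U}"

definition tvec_scale :: "real \<Rightarrow> 'm tvec \<Rightarrow> 'm tvec" where
  "tvec_scale c u = (\<lambda>f. c * u f)"

definition vf_at :: "'m vfield \<Rightarrow> 'm \<Rightarrow> 'm tvec" where
  "vf_at X p = (\<lambda>f. X f p)"

definition vector_fields ::
  "('m::topological_space, 'e::euclidean_space) chart set \<Rightarrow> 'm vfield set" where
  "vector_fields \<A> =
     {X. (\<forall>p. vf_at X p \<in> tangent_space \<A> p) \<and>
         (\<forall>f\<in>smooth_functions \<A>. X f \<in> smooth_functions \<A>)}"

definition fun_scale :: "('m \<Rightarrow> real) \<Rightarrow> 'm vfield \<Rightarrow> 'm vfield" where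
  "fun_scale h X = (\<lambda>f. h * X f)"

definition const_scale :: "real \<Rightarrow> 'm vfield \<Rightarrow> 'm vfield" where
  "const_scale c X = fun_scale (\<lambda>_. c) X"

definition lie_bracket :: "'m vfield \<Rightarrow> 'm vfield \<Rightarrow> 'm vfield" where
  "lie_bracket X Y = (\<lambda>f. X (Y f) - Y (X f))"

definition push_forward ::
  "('n::topological_space, 'f::euclidean_space) chart set \<Rightarrow> ('m \<Rightarrow> 'n) \<Rightarrow> 'm tvec \<Rightarrow> 'n tvec" where
  "push_forward \<B> F u = (\<lambda>f. if f \<in> smooth_functions \<B> then u (f \<circ> F) else 0)"

type_synonym 'm metric = "'m \<Rightarrow> 'm tvec \<Rightarrow> 'm tvec \<Rightarrow> real"
type_synonym 'm connection = "'m vfield \<Rightarrow> 'm vfield \<Rightarrow> 'm vfield"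
type_synonym 'm tensor2 = "'m vfield \<Rightarrow> 'm vfield \<Rightarrow> ('m \<Rightarrow> real)"
type_synonym 'm tensor4 =
  "'m vfield \<Rightarrow> 'm vfield \<Rightarrow> 'm vfield \<Rightarrow> 'm vfield \<Rightarrow> ('m \<Rightarrow> real)"

definition on_fields :: "'m metric \<Rightarrow> 'm tensor2" where
  "on_fields g X Y = (\<lambda>p. g p (vf_at X p) (vf_at Y p))"

text \<open>The last condition says that each scalar product has signature (+,...,+,-): there is a
  timelike vector, and its orthogonal complement is positive definite.\<close>

definition lorentzian_metric ::
  "('m::topological_space, 'e::euclidean_space) chart set \<Rightarrow> 'm metric \<Rightarrow> bool" where
  "lorentzian_metric \<A> g \<longleftrightarrow>
     (\<forall>p. \<forall>u\<in>tangent_space \<A> p. \<forall>v\<in>tangent_space \<A> p. g p u v = g p v u) \<and>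
     (\<forall>p. \<forall>u\<in>tangent_space \<A> p. \<forall>v\<in>tangent_space \<A> p. \<forall>w\<in>tangent_space \<A> p.
        g p (u + v) w = g p u w + g p v w) \<and>
     (\<forall>p c. \<forall>u\<in>tangent_space \<A> p. \<forall>v\<in>tangent_space \<A> p.
        g p (tvec_scale c u) v = c * g p u v) \<and>
     (\<forall>X\<in>vector_fields \<A>. \<forall>Y\<in>vector_fields \<A>. on_fields g X Y \<in> smooth_functions \<A>) \<and>
     (\<forall>p. \<exists>u\<in>tangent_space \<A> p. g p u u < 0 \<and>
        (\<forall>v\<in>tangent_space \<A> p. g p u v = 0 \<and> v \<noteq> 0 \<longrightarrow> g p v v > 0))"

definition affine_connection ::
  "('m::topological_space, 'e::euclidean_space) chart set \<Rightarrow> 'm connection \<Rightarrow> bool" where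
  "affine_connection \<A> D \<longleftrightarrow>
     (\<forall>X\<in>vector_fields \<A>. \<forall>Y\<in>vector_fields \<A>. D X Y \<in> vector_fields \<A>) \<and>
     (\<forall>X\<in>vector_fields \<A>. \<forall>X'\<in>vector_fields \<A>. \<forall>Y\<in>vector_fields \<A>.
        D (X + X') Y = D X Y + D X' Y) \<and>
     (\<forall>h\<in>smooth_functions \<A>. \<forall>X\<in>vector_fields \<A>. \<forall>Y\<in>vector_fields \<A>.
        D (fun_scale h X) Y = fun_scale h (D X Y)) \<and>
     (\<forall>X\<in>vector_fields \<A>. \<forall>Y\<in>vector_fields \<A>. \<forall>Y'\<in>vector_fields \<A>.
        D X (Y + Y') = D X Y + D X Y') \<and>
     (\<forall>h\<in>smooth_functions \<A>. \<forall>X\<in>vector_fields \<A>. \<forall>Y\<in>vector_fields \<A>.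
        D X (fun_scale h Y) = fun_scale (X h) Y + fun_scale h (D X Y))"

definition levi_civita ::
  "('m::topological_space, 'e::euclidean_space) chart set \<Rightarrow> 'm metric \<Rightarrow> 'm connection \<Rightarrow> bool" where
  "levi_civita \<A> g D \<longleftrightarrow> affine_connection \<A> D \<and>
     (\<forall>X\<in>vector_fields \<A>. \<forall>Y\<in>vector_fields \<A>. D X Y - D Y X = lie_bracket X Y) \<and>
     (\<forall>X\<in>vector_fields \<A>. \<forall>Y\<in>vector_fields \<A>. \<forall>Z\<in>vector_fields \<A>.
        X (on_fields g Y Z) = on_fields g (D X Y) Z + on_fields g Y (D X Z))"

definition curvature :: "'m connection \<Rightarrow> 'm vfield \<Rightarrow> 'm vfield \<Rightarrow> 'm vfield \<Rightarrow> 'm vfield" where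
  "curvature D X Y Z = D X (D Y Z) - D Y (D X Z) - D (lie_bracket X Y) Z"

definition curvature4 :: "'m metric \<Rightarrow> 'm connection \<Rightarrow> 'm tensor4" where
  "curvature4 g D X Y Z W = - on_fields g (curvature D X Y Z) W"

text \<open>The Lie derivative of a (0,2)-tensor, written via the product rule for
  the Lie derivative of the function T(X, Y).\<close>

definition lie_derivative :: "'m vfield \<Rightarrow> 'm tensor2 \<Rightarrow> 'm tensor2" where
  "lie_derivative V T X Y = V (T X Y) - T (lie_bracket V X) Y - T X (lie_bracket V Y)"

definition kulkarni_nomizu :: "'m tensor2 \<Rightarrow> 'm tensor2 \<Rightarrow> 'm tensor4" where
  "kulkarni_nomizu T1 T2 X Y Z W =
     T1 X W * T2 Y Z + T1 Y Z * T2 X W - T1 X Z * T2 Y W - T1 Y W * T2 X Z"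

locale lie_group = group G
  for G :: "'m::{t2_space, second_countable_topology} monoid" (structure) +
  fixes \<A> :: "('m, 'e::euclidean_space) chart set"
  assumes carrier_UNIV: "carrier G = UNIV"
    and atlas: "smooth_atlas \<A>"
    and smooth_mult: "smooth_map (prod_atlas \<A> \<A>) \<A> (\<lambda>(x, y). mult G x y)"
    and smooth_inverse: "smooth_map \<A> \<A> (\<lambda>x. m_inv G x)"

definition lie_algebra ::
  "'m::topological_space monoid \<Rightarrow> ('m, 'e::euclidean_space) chart set \<Rightarrow> 'm vfield set" where
  "lie_algebra G \<A> =
     {X \<in> vector_fields \<A>. \<forall>a p. push_forward \<A> (mult G a) (vf_at X p) = vf_at X (mult G a p)}"

definition lie_algebra_basis3 ::
  "'m::topological_space monoid \<Rightarrow> ('m, 'e::euclidean_space) chart set \<Rightarrow>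
   'm vfield \<Rightarrow> 'm vfield \<Rightarrow> 'm vfield \<Rightarrow> bool" where
  "lie_algebra_basis3 G \<A> e1 e2 e3 \<longleftrightarrow>
     e1 \<in> lie_algebra G \<A> \<and> e2 \<in> lie_algebra G \<A> \<and> e3 \<in> lie_algebra G \<A> \<and>
     (\<forall>a b c. const_scale a e1 + const_scale b e2 + const_scale c e3 = 0
        \<longrightarrow> a = 0 \<and> b = 0 \<and> c = 0) \<and>
     (\<forall>X\<in>lie_algebra G \<A>. \<exists>a b c. X = const_scale a e1 + const_scale b e2 + const_scale c e3)"

definition left_invariant_metric ::
  "'m::topological_space monoid \<Rightarrow> ('m, 'e::euclidean_space) chart set \<Rightarrow> 'm metric \<Rightarrow> bool" where
  "left_invariant_metric G \<A> g \<longleftrightarrow>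
     (\<forall>a p. \<forall>u\<in>tangent_space \<A> p. \<forall>v\<in>tangent_space \<A> p.
        g (mult G a p) (push_forward \<A> (mult G a) u) (push_forward \<A> (mult G a) v) = g p u v)"

definition pseudo_orthonormal3 ::
  "'m metric \<Rightarrow> 'm vfield \<Rightarrow> 'm vfield \<Rightarrow> 'm vfield \<Rightarrow> bool" where
  "pseudo_orthonormal3 g e1 e2 e3 \<longleftrightarrow>
     (\<forall>p. on_fields g e1 e1 p = 1 \<and> on_fields g e2 e2 p = 1 \<and> on_fields g e3 e3 p = -1 \<and>
          on_fields g e1 e2 p = 0 \<and> on_fields g e1 e3 p = 0 \<and> on_fields g e2 e3 p = 0)"

definition left_invariant_riemann_soliton ::
  "'m::topological_space monoid \<Rightarrow> ('m, 'e::euclidean_space) chart set \<Rightarrow> 'm metric \<Rightarrow>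
   'm connection \<Rightarrow> 'm vfield \<Rightarrow> real \<Rightarrow> bool" where
  "left_invariant_riemann_soliton G \<A> g D V l \<longleftrightarrow>
     V \<in> lie_algebra G \<A> \<and>
     (\<forall>X\<in>vector_fields \<A>. \<forall>Y\<in>vector_fields \<A>. \<forall>Z\<in>vector_fields \<A>. \<forall>W\<in>vector_fields \<A>. \<forall>p.
        curvature4 g D X Y Z W p
        + (1/2) * kulkarni_nomizu (lie_derivative V (on_fields g)) (on_fields g) X Y Z W p
        = (l/2) * kulkarni_nomizu (on_fields g) (on_fields g) X Y Z W p)"

end

theory Submission
  imports Defs
begin

text \<open>The Koszul formula determines the connection on the frame, so both sides of the soliton
  equation have constant coefficients on left-invariant fields. There \<open>L\<^sub>V g\<close> has only
  off-diagonal entries, while the curvature is diagonal on the planes spanned by pairs of frame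
  fields; hence the equation splits into "V is Killing" and "the curvature is constant". Both sides
  are tensorial and every vector field is a combination of the frame with smooth coefficients, so
  it is enough to test the frame.\<close>

section \<open>Smooth functions and tangent vectors\<close>

text \<open>Tangent vectors are functionals and fields are operators on functions, so linear algebra
  at a point has to pass through a chart: each tangent space is the linear image of the model space,
  and the dimension count that makes the frame span is done in \<open>real^3\<close>. The
  coefficients of a field in the frame are its products with \<open>e1\<close>, \<open>e2\<close>,
  \<open>e3\<close>, which makes them smooth. The case list has a hidden symmetry. In terms of the
  connection coefficients \<open>a\<close>, \<open>b\<close>, \<open>c\<close>, eliminating
  \<open>l\<close> from the curvature equations leaves \<open>a * (b + c) = 0\<close>,
  \<open>b * (a - c) = 0\<close>, \<open>c * (a + b) = 0\<close>. The second factors equal \<beta> -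
  \<gamma>, \<gamma> - \<alpha>, \<beta> - \<alpha> and are also the factors of \<open>l1\<close>,
  \<open>l2\<close>, \<open>l3\<close> in the Killing equations. So either two of \<open>a\<close>,
  \<open>b\<close>, \<open>c\<close> vanish, which forces flatness and \<open>l = 0\<close>, or
  \<alpha> = \<beta> = \<gamma>, when every left-invariant field is Killing and \<open>l\<close> is
  a quarter of the square of \<alpha>.\<close>

text \<open>Openness makes derivatives local. This allows the derivative of a sum or product to be
  replaced by a formula that is valid only on \<open>S\<close>.\<close>

lemma Ck_on_cong:
  assumes "open S" "\<And>x. x \<in> S \<Longrightarrow> f x = g x" "Ck_on k S f"
  shows "Ck_on k S g"
  using assms(2,3)
proof (induction k arbitrary: f g)
  case 0
  then show ?case by (simp cong: continuous_on_cong)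
next
  case (Suc k)
  have *: "(g has_derivative frechet_derivative f (at x)) (at x)" if "x \<in> S" for x
    using that Suc.prems frechet_derivative_works has_derivative_transform_within_open[OF _ assms(1)]
    by (metis Ck_on.simps(2))
  have "frechet_derivative f (at x) v = frechet_derivative g (at x) v" if "x \<in> S" for x v
    using frechet_derivative_at[OF *[OF that]] by simp
  with Suc.IH[of "\<lambda>x. frechet_derivative f (at x) _" "\<lambda>x. frechet_derivative g (at x) _"] Suc.prems(2) *
  show ?case unfolding Ck_on.simps differentiable_def by blast
qed

text \<open>Serves the product rule, where undifferentiated factors appear next to derivatives that
  have one order less.\<close>

lemma Ck_on_Suc_imp: "Ck_on (Suc k) S f \<Longrightarrow> Ck_on k S f"
proof (induction k arbitrary: f)
  case 0
  then show ?case
    by (auto intro!: continuous_at_imp_continuous_on differentiable_imp_continuous_within)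
next
  case (Suc k)
  then show ?case unfolding Ck_on.simps(2)[of "Suc k"] Ck_on.simps(2)[of k] by blast
qed

lemma Ck_on_const: "Ck_on k S (\<lambda>_. c)"
  by (induction k arbitrary: c) (simp_all add: frechet_derivative_const)

lemma Ck_on_add:
  assumes "open S" "Ck_on k S f" "Ck_on k S g"
  shows "Ck_on k S (\<lambda>x. f x + g x)"
  using assms(2,3)
proof (induction k arbitrary: f g)
  case 0
  then show ?case by (simp add: continuous_on_add)
next
  case (Suc k)
  have "Ck_on k S (\<lambda>x. frechet_derivative (\<lambda>x. f x + g x) (at x) v)" for v
  proof (rule Ck_on_cong[OF assms(1)])
    show "Ck_on k S (\<lambda>x. frechet_derivative f (at x) v + frechet_derivative g (at x) v)"
      using Suc by simp
    show "frechet_derivative f (at x) v + frechet_derivative g (at x) v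
      = frechet_derivative (\<lambda>x. f x + g x) (at x) v" if "x \<in> S" for x
      using Suc.prems that has_derivative_add[of f _ "at x" g]
      by (subst frechet_derivative_at[symmetric]) (auto simp: frechet_derivative_works)
  qed
  with Suc.prems show ?case by simp
qed

lemma Ck_on_mult:
  fixes f g :: "'a::euclidean_space \<Rightarrow> real"
  assumes "open S" "Ck_on k S f" "Ck_on k S g"
  shows "Ck_on k S (\<lambda>x. f x * g x)"
  using assms(2,3)
proof (induction k arbitrary: f g)
  case 0
  then show ?case by (simp add: continuous_on_mult)
next
  case (Suc k)
  have "Ck_on k S (\<lambda>x. frechet_derivative (\<lambda>x. f x * g x) (at x) v)" for v
  proof (rule Ck_on_cong[OF assms(1)])
    show "Ck_on k S (\<lambda>x. f x * frechet_derivative g (at x) v + frechet_derivative f (at x) v * g x)"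
      using Suc.prems Suc.prems[THEN Ck_on_Suc_imp] Suc.IH by (intro Ck_on_add[OF assms(1)]) auto
    show "f x * frechet_derivative g (at x) v + frechet_derivative f (at x) v * g x
      = frechet_derivative (\<lambda>x. f x * g x) (at x) v" if "x \<in> S" for x
      using Suc.prems that has_derivative_mult[of f _ x UNIV g]
      by (subst frechet_derivative_at[symmetric]) (auto simp: frechet_derivative_works)
  qed
  with Suc.prems show ?case by simp
qed

lemma smooth_onD:
  assumes "smooth_on S f" "x \<in> S"
  shows "f differentiable at x" "open S"
proof -
  have "Ck_on (Suc 0) S f" and "open S" using assms(1) unfolding smooth_on_def by blast+
  then show "f differentiable at x" "open S" using assms(2) by auto
qed

lemma smooth_functions_iff:
  "f \<in> smooth_functions \<A> \<longleftrightarrow>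
    continuous_on UNIV f \<and> (\<forall>(U, \<phi>)\<in>\<A>. smooth_on (\<phi> ` U) (f \<circ> inv_into U \<phi>))"
  by (simp add: smooth_functions_def smooth_map_def)

lemma smooth_functions_add:
  assumes "f \<in> smooth_functions \<A>" "h \<in> smooth_functions \<A>"
  shows "f + h \<in> smooth_functions \<A>"
  unfolding smooth_functions_iff
proof (intro conjI ballI, safe)
  show "continuous_on UNIV (f + h)"
    using assms by (auto simp: smooth_functions_iff plus_fun_def intro: continuous_on_add)
  fix U \<phi> assume "(U, \<phi>) \<in> \<A>"
  then have "smooth_on (\<phi> ` U) (f \<circ> inv_into U \<phi>)" "smooth_on (\<phi> ` U) (h \<circ> inv_into U \<phi>)"
    using assms by (auto simp: smooth_functions_iff)
  then show "smooth_on (\<phi> ` U) ((f + h) \<circ> inv_into U \<phi>)"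
    by (auto simp: smooth_on_def o_def intro: Ck_on_add)
qed

lemma smooth_functions_mult:
  assumes "f \<in> smooth_functions \<A>" "h \<in> smooth_functions \<A>"
  shows "f * h \<in> smooth_functions \<A>"
  unfolding smooth_functions_iff
proof (intro conjI ballI, safe)
  show "continuous_on UNIV (f * h)"
    using assms by (auto simp: smooth_functions_iff times_fun_def intro: continuous_on_mult)
  fix U \<phi> assume "(U, \<phi>) \<in> \<A>"
  then have "smooth_on (\<phi> ` U) (f \<circ> inv_into U \<phi>)" "smooth_on (\<phi> ` U) (h \<circ> inv_into U \<phi>)"
    using assms by (auto simp: smooth_functions_iff)
  then show "smooth_on (\<phi> ` U) ((f * h) \<circ> inv_into U \<phi>)"
    by (auto simp: smooth_on_def o_def intro: Ck_on_mult)
qed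

section \<open>Fields as a module over functions\<close>

lemma fun_scale_apply: "fun_scale h X f p = h p * X f p"
  by (simp add: fun_scale_def)

lemma fun_scale_simps:
  "fun_scale h (X + Y) = fun_scale h X + fun_scale h Y"
  "fun_scale h (X - Y) = fun_scale h X - fun_scale h Y"
  "fun_scale h (- X) = - fun_scale h X"
  "fun_scale (h + k) X = fun_scale h X + fun_scale k X"
  "fun_scale (h - k) X = fun_scale h X - fun_scale k X"
  "fun_scale (- h) X = - fun_scale h X"
  "fun_scale (h * k) X = fun_scale h (fun_scale k X)"
  "fun_scale h 0 = 0" "fun_scale 0 X = 0" "fun_scale (\<lambda>_. 0) X = 0"
  by (simp_all add: fun_eq_iff fun_scale_apply algebra_simps)

lemma fun_scale_commute: "fun_scale h (fun_scale k X) = fun_scale k (fun_scale h X)"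
  by (simp add: fun_eq_iff fun_scale_apply)

lemma const_scale_simps: "const_scale 0 X = 0" "const_scale 1 X = X"
  "const_scale (-1) X = - X"
  by (simp_all add: const_scale_def fun_eq_iff fun_scale_apply)

text \<open>\<open>tangent_space\<close> collects vectors from all charts around the point. Naming
  the vectors of one chart makes their dependence on \<open>w\<close> visible as a linear
  map.\<close>

definition chart_tvec ::
  "('m::topological_space, 'e::euclidean_space) chart set \<Rightarrow> ('m, 'e) chart \<Rightarrow> 'm \<Rightarrow> 'e \<Rightarrow> 'm tvec" where
  "chart_tvec \<A> c p w = (\<lambda>f. if f \<in> smooth_functions \<A>
     then frechet_derivative (f \<circ> inv_into (fst c) (snd c)) (at (snd c p)) w else 0)"

section \<open>Tangent spaces in a chart, closure of vector fields\<close>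

locale smooth_manifold =
  fixes \<A> :: "('m::topological_space, 'e::euclidean_space) chart set"
  assumes atlas: "smooth_atlas \<A>"
begin

abbreviation "C \<equiv> smooth_functions \<A>"
abbreviation "VF \<equiv> vector_fields \<A>"

lemma chart_domain_open:
  assumes "(U, \<phi>) \<in> \<A>"
  shows "open (\<phi> ` U)"
proof -
  have "is_chart (U, \<phi>)" using atlas assms unfolding smooth_atlas_def by blast
  then show ?thesis by (simp add: is_chart_def)
qed

lemma smooth_const: "(\<lambda>_. r) \<in> C"
  by (auto simp: smooth_functions_iff smooth_on_def o_def Ck_on_const chart_domain_open)

lemma chart_at: obtains c where "c \<in> \<A>" "p \<in> fst c"
proof -
  have "p \<in> (\<Union>(U, \<phi>)\<in>\<A>. U)" using atlas unfolding smooth_atlas_def by simp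
  then show ?thesis using that by fastforce
qed

lemma chart_inv:
  assumes "c \<in> \<A>" "p \<in> fst c"
  shows "inv_into (fst c) (snd c) (snd c p) = p"
  using assms atlas unfolding smooth_atlas_def is_chart_def homeomorphism_def by fastforce

lemma smooth_differentiable:
  assumes "f \<in> C" "c \<in> \<A>" "p \<in> fst c"
  shows "(f \<circ> inv_into (fst c) (snd c)) differentiable at (snd c p)"
  using assms smooth_onD(1) unfolding smooth_functions_iff by fastforce

lemma smooth_has_derivative:
  assumes "f \<in> C" "c \<in> \<A>" "p \<in> fst c"
  shows "((f \<circ> inv_into (fst c) (snd c)) has_derivative (\<lambda>w. chart_tvec \<A> c p w f)) (at (snd c p))"
  using smooth_differentiable[OF assms] assms(1)
  by (simp add: chart_tvec_def frechet_derivative_works)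

text \<open>Chain rule: the new coordinate vector is the derivative of the transition map applied to
  \<open>w\<close>.\<close>

lemma chart_tvec_change:
  assumes c: "c \<in> \<A>" "p \<in> fst c" and d: "d \<in> \<A>" "p \<in> fst d"
  shows "\<exists>w'. chart_tvec \<A> d p w = chart_tvec \<A> c p w'"
proof -
  define T where "T = snd c \<circ> inv_into (fst d) (snd d)"
  let ?S = "snd d ` (fst d \<inter> fst c)"
  have sm: "smooth_on ?S T"
    using atlas c d unfolding smooth_atlas_def T_def by fastforce
  have pin: "snd d p \<in> ?S" using c d by auto
  note T = smooth_onD[OF sm pin]
  have Tp: "T (snd d p) = snd c p" by (simp add: T_def chart_inv d)
  let ?w = "frechet_derivative T (at (snd d p)) w"
  have "chart_tvec \<A> d p w f = chart_tvec \<A> c p ?w f" if f: "f \<in> C" for f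
  proof -
    have "((f \<circ> inv_into (fst c) (snd c) \<circ> T) has_derivative
        (\<lambda>w. chart_tvec \<A> c p w f) \<circ> frechet_derivative T (at (snd d p))) (at (snd d p))"
      using T(1) smooth_has_derivative[OF f c] Tp
      by (intro diff_chain_at) (simp_all add: frechet_derivative_works)
    moreover have "(f \<circ> inv_into (fst c) (snd c) \<circ> T) x = (f \<circ> inv_into (fst d) (snd d)) x"
      if "x \<in> ?S" for x
      using that c d by (auto simp: T_def chart_inv)
    \<comment> \<open>The two coordinate expressions of \<open>f\<close> agree only on the image of
      the overlap, but this is open and contains the point, so they share a derivative
      there.\<close>
    ultimately have "((f \<circ> inv_into (fst d) (snd d)) has_derivative
        (\<lambda>w. chart_tvec \<A> c p w f) \<circ> frechet_derivative T (at (snd d p))) (at (snd d p))"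
      using has_derivative_transform_within_open T(2) pin by blast
    from has_derivative_unique[OF this smooth_has_derivative[OF f d]]
    show ?thesis by (metis comp_apply)
  qed
  moreover have "chart_tvec \<A> d p w f = chart_tvec \<A> c p ?w f" if f: "f \<notin> C" for f
    using that by (simp add: chart_tvec_def)
  ultimately show ?thesis by blast
qed

text \<open>One chart suffices, so the tangent space is the image of a linear map. Its closure under
  sums and multiples follows from this.\<close>

lemma tangent_space_eq:
  assumes c: "c \<in> \<A>" "p \<in> fst c"
  shows "tangent_space \<A> p = range (chart_tvec \<A> c p)"
proof -
  have *: "tangent_space \<A> p = (\<Union>d\<in>{d\<in>\<A>. p \<in> fst d}. range (chart_tvec \<A> d p))"
    unfolding tangent_space_def chart_tvec_def by force
  show ?thesis
  proof
    show "tangent_space \<A> p \<subseteq> range (chart_tvec \<A> c p)"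
      unfolding * using chart_tvec_change[OF c] by fastforce
  qed (use c * in auto)
qed

lemma chart_tvec_add:
  assumes c: "c \<in> \<A>" "p \<in> fst c"
  shows "chart_tvec \<A> c p (v + w) = chart_tvec \<A> c p v + chart_tvec \<A> c p w"
proof
  fix f
  show "chart_tvec \<A> c p (v + w) f = (chart_tvec \<A> c p v + chart_tvec \<A> c p w) f"
  proof (cases "f \<in> C")
    case True
    from has_derivative_linear[OF smooth_has_derivative[OF True c]]
    show ?thesis by (simp add: linear_add[of "\<lambda>w. chart_tvec \<A> c p w f"])
  qed (simp add: chart_tvec_def)
qed

lemma chart_tvec_scale:
  assumes c: "c \<in> \<A>" "p \<in> fst c"
  shows "chart_tvec \<A> c p (r *\<^sub>R w) = tvec_scale r (chart_tvec \<A> c p w)"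
proof
  fix f
  show "chart_tvec \<A> c p (r *\<^sub>R w) f = tvec_scale r (chart_tvec \<A> c p w) f"
  proof (cases "f \<in> C")
    case True
    from has_derivative_linear[OF smooth_has_derivative[OF True c]]
    show ?thesis by (simp add: linear_scale[of "\<lambda>w. chart_tvec \<A> c p w f"] tvec_scale_def)
  qed (simp add: chart_tvec_def tvec_scale_def)
qed

lemma tangent_space_add:
  assumes "u \<in> tangent_space \<A> p" "v \<in> tangent_space \<A> p"
  shows "u + v \<in> tangent_space \<A> p"
proof -
  obtain c where c: "c \<in> \<A>" "p \<in> fst c" by (rule chart_at)
  obtain a b where "u = chart_tvec \<A> c p a" "v = chart_tvec \<A> c p b"
    using assms unfolding tangent_space_eq[OF c] by auto
  then have "u + v = chart_tvec \<A> c p (a + b)" by (simp only: chart_tvec_add[OF c])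
  then show ?thesis unfolding tangent_space_eq[OF c] by blast
qed

lemma tangent_space_scale:
  assumes "u \<in> tangent_space \<A> p"
  shows "tvec_scale r u \<in> tangent_space \<A> p"
proof -
  obtain c where c: "c \<in> \<A>" "p \<in> fst c" by (rule chart_at)
  obtain a where "u = chart_tvec \<A> c p a"
    using assms unfolding tangent_space_eq[OF c] by auto
  then have "tvec_scale r u = chart_tvec \<A> c p (r *\<^sub>R a)" by (simp only: chart_tvec_scale[OF c])
  then show ?thesis unfolding tangent_space_eq[OF c] by blast
qed

lemma vf_at_tangent: "X \<in> VF \<Longrightarrow> vf_at X p \<in> tangent_space \<A> p"
  by (simp add: vector_fields_def)

lemma tangent_vector_const:
  assumes "u \<in> tangent_space \<A> p"
  shows "u (\<lambda>_. r) = 0"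
proof -
  obtain c where c: "c \<in> \<A>" "p \<in> fst c" by (rule chart_at)
  obtain w where u: "u = chart_tvec \<A> c p w" using assms tangent_space_eq[OF c] by auto
  show ?thesis
    using has_derivative_unique[OF has_derivative_const smooth_has_derivative[OF smooth_const c, unfolded o_def]]
    by (simp add: u fun_eq_iff)
qed

lemma vector_field_const: "X \<in> VF \<Longrightarrow> X (\<lambda>_. r) = 0"
  using tangent_vector_const[OF vf_at_tangent] by (simp add: vf_at_def fun_eq_iff)

lemma vector_field_smooth: "X \<in> VF \<Longrightarrow> f \<in> C \<Longrightarrow> X f \<in> C"
  by (simp add: vector_fields_def)

lemma vf_at_add: "vf_at (X + Y) p = vf_at X p + vf_at Y p"
  by (simp add: vf_at_def fun_eq_iff)

lemma vf_at_scale: "vf_at (fun_scale h X) p = tvec_scale (h p) (vf_at X p)"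
  by (simp add: vf_at_def fun_scale_def tvec_scale_def fun_eq_iff)

lemma vector_fields_add:
  assumes "X \<in> VF" "Y \<in> VF"
  shows "X + Y \<in> VF"
  using assms by (simp add: vector_fields_def vf_at_add tangent_space_add smooth_functions_add)

lemma vector_fields_scale:
  assumes "h \<in> C" "X \<in> VF"
  shows "fun_scale h X \<in> VF"
  using assms
  by (simp add: vector_fields_def vf_at_scale tangent_space_scale)
    (simp add: fun_scale_def smooth_functions_mult)

lemma vector_fields_const_scale [simp]: "X \<in> VF \<Longrightarrow> const_scale r X \<in> VF"
  by (simp add: const_scale_def vector_fields_scale smooth_const)

lemma vector_fields_uminus [simp]: "X \<in> VF \<Longrightarrow> - X \<in> VF"
  using vector_fields_const_scale[of X "-1"] by (simp add: const_scale_simps)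

lemma vector_fields_diff [simp]: "X \<in> VF \<Longrightarrow> Y \<in> VF \<Longrightarrow> X - Y \<in> VF"
  using vector_fields_add[of X "- Y"] by simp

declare vector_fields_add [simp] vector_fields_scale [simp] vector_field_smooth [simp]
  smooth_functions_add [simp] smooth_functions_mult [simp] smooth_const [simp]

text \<open>Push-forward is linear because its default value off smooth functions is 0. Together
  with the scaling lemma this gives the left invariance of \<open>V\<close> that the soliton
  definition demands.\<close>

lemma lie_algebra_add:
  assumes "X \<in> lie_algebra G \<A>" "Y \<in> lie_algebra G \<A>"
  shows "X + Y \<in> lie_algebra G \<A>"
proof -
  have "push_forward \<A> F (u + v) = push_forward \<A> F u + push_forward \<A> F v"
    for F :: "'m \<Rightarrow> 'm" and u v
    by (auto simp: push_forward_def)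
  then show ?thesis using assms by (simp add: lie_algebra_def vf_at_add)
qed

lemma lie_algebra_const_scale:
  assumes "X \<in> lie_algebra G \<A>"
  shows "const_scale r X \<in> lie_algebra G \<A>"
proof -
  have "push_forward \<A> F (tvec_scale r u) = tvec_scale r (push_forward \<A> F u)"
    for F :: "'m \<Rightarrow> 'm" and u
    by (auto simp: push_forward_def tvec_scale_def)
  then show ?thesis using assms by (simp add: lie_algebra_def) (simp add: const_scale_def vf_at_scale)
qed

end

section \<open>Curvature and Lie derivative of a Lorentzian metric\<close>

locale lorentzian_manifold = smooth_manifold \<A>
  for \<A> :: "('m::topological_space, 'e::euclidean_space) chart set" +
  fixes g :: "'m metric" and D :: "'m connection"
  assumes metric: "lorentzian_metric \<A> g" and levi_civita: "levi_civita \<A> g D"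
begin

abbreviation "gf \<equiv> on_fields g"

lemma gf_smooth [simp]: "X \<in> VF \<Longrightarrow> Y \<in> VF \<Longrightarrow> gf X Y \<in> C"
  using metric by (simp add: lorentzian_metric_def)

lemma g_sym: "u \<in> tangent_space \<A> p \<Longrightarrow> v \<in> tangent_space \<A> p \<Longrightarrow> g p u v = g p v u"
  using metric by (simp add: lorentzian_metric_def)

lemma g_add: "u \<in> tangent_space \<A> p \<Longrightarrow> v \<in> tangent_space \<A> p \<Longrightarrow> w \<in> tangent_space \<A> p \<Longrightarrow>
   g p (u + v) w = g p u w + g p v w"
  using metric by (simp add: lorentzian_metric_def)

lemma g_scale: "u \<in> tangent_space \<A> p \<Longrightarrow> v \<in> tangent_space \<A> p \<Longrightarrow>
   g p (tvec_scale r u) v = r * g p u v"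
  using metric by (simp add: lorentzian_metric_def)

lemma gf_sym: "X \<in> VF \<Longrightarrow> Y \<in> VF \<Longrightarrow> gf X Y = gf Y X"
  by (simp add: on_fields_def fun_eq_iff g_sym vf_at_tangent)

lemma gf_add [simp]:
  assumes "X \<in> VF" "Y \<in> VF" "Z \<in> VF"
  shows "gf (X + Y) Z = gf X Z + gf Y Z" "gf Z (X + Y) = gf Z X + gf Z Y"
proof -
  show 1: "gf (X + Y) Z = gf X Z + gf Y Z"
    using assms by (simp add: on_fields_def fun_eq_iff vf_at_add g_add vf_at_tangent)
  show "gf Z (X + Y) = gf Z X + gf Z Y"
    using 1 assms gf_sym by simp
qed

lemma gf_scale [simp]:
  assumes "h \<in> C" "X \<in> VF" "Y \<in> VF"
  shows "gf (fun_scale h X) Y = h * gf X Y" "gf Y (fun_scale h X) = h * gf Y X"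
proof -
  show 1: "gf (fun_scale h X) Y = h * gf X Y"
    using assms by (simp add: on_fields_def fun_eq_iff vf_at_scale g_scale vf_at_tangent)
  show "gf Y (fun_scale h X) = h * gf Y X"
    using 1 assms gf_sym[of Y] by simp
qed

lemma gf_const_scale [simp]:
  assumes "X \<in> VF" "Y \<in> VF"
  shows "gf (const_scale r X) Y = (\<lambda>_. r) * gf X Y" "gf Y (const_scale r X) = (\<lambda>_. r) * gf Y X"
  using assms by (simp_all add: const_scale_def)

lemma gf_uminus [simp]:
  assumes "X \<in> VF" "Y \<in> VF"
  shows "gf (- X) Y = - gf X Y" "gf Y (- X) = - gf Y X"
  using gf_const_scale[OF assms, of "-1"] by (simp_all add: const_scale_simps fun_eq_iff)

lemma gf_diff [simp]:
  assumes "X \<in> VF" "Y \<in> VF" "Z \<in> VF"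
  shows "gf (X - Y) Z = gf X Z - gf Y Z" "gf Z (X - Y) = gf Z X - gf Z Y"
  using assms gf_add[of X "- Y" Z] by simp_all

lemma
  assumes "X \<in> VF" "Y \<in> VF"
  shows D_closed [simp]: "D X Y \<in> VF"
    and D_add_left [simp]: "X' \<in> VF \<Longrightarrow> D (X + X') Y = D X Y + D X' Y"
    and D_add_right [simp]: "Y' \<in> VF \<Longrightarrow> D X (Y + Y') = D X Y + D X Y'"
    and D_scale_left [simp]: "h \<in> C \<Longrightarrow> D (fun_scale h X) Y = fun_scale h (D X Y)"
    and D_scale_right [simp]: "h \<in> C \<Longrightarrow> D X (fun_scale h Y) = fun_scale (X h) Y + fun_scale h (D X Y)"
    and lie_bracket_eq: "lie_bracket X Y = D X Y - D Y X"
    and D_metric: "Z \<in> VF \<Longrightarrow> X (gf Y Z) = gf (D X Y) Z + gf Y (D X Z)"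
  using levi_civita assms unfolding levi_civita_def affine_connection_def by metis+

lemma D_const_scale [simp]:
  assumes "X \<in> VF" "Y \<in> VF"
  shows "D (const_scale r X) Y = const_scale r (D X Y)" "D X (const_scale r Y) = const_scale r (D X Y)"
  using assms by (simp_all add: const_scale_def vector_field_const fun_scale_simps)

lemma D_uminus [simp]:
  assumes "X \<in> VF" "Y \<in> VF"
  shows "D (- X) Y = - D X Y" "D X (- Y) = - D X Y"
  using D_const_scale[OF assms, of "-1"] by (simp_all add: const_scale_simps)

lemma D_diff [simp]:
  assumes "X \<in> VF" "Y \<in> VF" "Z \<in> VF"
  shows "D (X - Y) Z = D X Z - D Y Z" "D Z (X - Y) = D Z X - D Z Y"
  using assms D_add_left[of X Z "- Y"] D_add_right[of Z X "- Y"] by simp_all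

section \<open>Tensoriality of the curvature and of the Lie derivative\<close>

lemma lie_bracket_apply:
  assumes "X \<in> VF" "Y \<in> VF"
  shows "D X Y h - D Y X h = X (Y h) - Y (X h)"
  using fun_cong[OF lie_bracket_eq[OF assms], of h] by (simp add: lie_bracket_def)

text \<open>Removing the bracket by torsion-freeness leaves only \<open>D\<close>, so its linearity
  and Leibniz rules do all the work.\<close>

lemma curvature_eq:
  "X \<in> VF \<Longrightarrow> Y \<in> VF \<Longrightarrow> Z \<in> VF \<Longrightarrow>
   curvature D X Y Z = D X (D Y Z) - D Y (D X Z) - D (D X Y) Z + D (D Y X) Z"
  by (simp add: curvature_def lie_bracket_eq)

lemma curvature_add [simp]:
  assumes "X \<in> VF" "Y \<in> VF" "Z \<in> VF" "W \<in> VF"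
  shows "curvature D (X + W) Y Z = curvature D X Y Z + curvature D W Y Z"
    and "curvature D X (Y + W) Z = curvature D X Y Z + curvature D X W Z"
    and "curvature D X Y (Z + W) = curvature D X Y Z + curvature D X Y W"
  using assms by (simp_all add: curvature_eq)

lemma curvature_swap:
  assumes "X \<in> VF" "Y \<in> VF" "Z \<in> VF"
  shows "curvature D X Y Z = - curvature D Y X Z"
  using assms by (simp add: curvature_eq)

lemma curvature_scale [simp]:
  assumes "X \<in> VF" "Y \<in> VF" "Z \<in> VF" "h \<in> C"
  shows "curvature D (fun_scale h X) Y Z = fun_scale h (curvature D X Y Z)"
    and "curvature D X (fun_scale h Y) Z = fun_scale h (curvature D X Y Z)"
    and "curvature D X Y (fun_scale h Z) = fun_scale h (curvature D X Y Z)"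
proof -
  have 1: "curvature D (fun_scale h X) Y Z = fun_scale h (curvature D X Y Z)"
    if "X \<in> VF" "Y \<in> VF" for X Y
    using that assms by (simp add: curvature_eq fun_scale_simps)
  then show "curvature D (fun_scale h X) Y Z = fun_scale h (curvature D X Y Z)"
    using assms by simp
  show "curvature D X (fun_scale h Y) Z = fun_scale h (curvature D X Y Z)"
    using 1[of Y X] assms curvature_swap[of X _ Z] by (simp add: fun_scale_simps)
  \<comment> \<open>The first-order terms in \<open>h\<close> cancel. What survives is the bracket
    acting on \<open>h\<close>, once as a commutator and once as \<open>D X Y - D Y X\<close>; these
    agree.\<close>
  have "curvature D X Y (fun_scale h Z) =
     fun_scale h (curvature D X Y Z) + fun_scale (X (Y h) - Y (X h) - (D X Y h - D Y X h)) Z"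
    using assms by (simp add: curvature_eq fun_scale_simps)
  then show "curvature D X Y (fun_scale h Z) = fun_scale h (curvature D X Y Z)"
    using assms by (simp add: lie_bracket_apply fun_scale_simps)
qed

text \<open>Metric compatibility expands the derivative along \<open>V\<close>, and its
  \<open>D V\<close> terms cancel against those of the brackets. The remaining form is visibly
  tensorial in \<open>X\<close> and \<open>Y\<close>.\<close>

lemma lie_derivative_eq:
  assumes "V \<in> VF" "X \<in> VF" "Y \<in> VF"
  shows "lie_derivative V gf X Y = gf (D X V) Y + gf X (D Y V)"
  using assms by (simp add: lie_derivative_def lie_bracket_eq D_metric fun_eq_iff)

lemma lie_derivative_sym:
  assumes "V \<in> VF" "X \<in> VF" "Y \<in> VF"
  shows "lie_derivative V gf X Y = lie_derivative V gf Y X"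
  using assms by (simp add: lie_derivative_eq gf_sym add.commute)

lemma lie_derivative_add [simp]:
  assumes "V \<in> VF" "X \<in> VF" "Y \<in> VF" "Z \<in> VF"
  shows "lie_derivative V gf (X + Z) Y = lie_derivative V gf X Y + lie_derivative V gf Z Y"
  using assms by (simp add: lie_derivative_eq)

lemma lie_derivative_scale [simp]:
  assumes "V \<in> VF" "X \<in> VF" "Y \<in> VF" "h \<in> C"
  shows "lie_derivative V gf (fun_scale h X) Y = h * lie_derivative V gf X Y"
  using assms by (simp add: lie_derivative_eq algebra_simps)

text \<open>Constant inner products have zero derivative, so metric compatibility becomes three
  skew-symmetry relations. Torsion-freeness lets them be solved for one connection
  coefficient.\<close>

lemma koszul_const:
  assumes "X \<in> VF" "Y \<in> VF" "Z \<in> VF"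
    and c: "gf X Y = (\<lambda>_. r)" "gf Y Z = (\<lambda>_. s)" "gf X Z = (\<lambda>_. t)"
  shows "gf (D X Y) Z p =
    (gf (lie_bracket X Y) Z p - gf (lie_bracket Y Z) X p + gf (lie_bracket Z X) Y p) / 2"
proof -
  have *: "gf (D A B) E p + gf (D A E) B p = 0"
    if "A \<in> VF" "B \<in> VF" "E \<in> VF" "gf B E = (\<lambda>_. k)" for A B E k
    using fun_cong[OF D_metric[OF that(1,2,3)], of p] that
    by (simp add: vector_field_const gf_sym[of B])
  have "gf (D X Y) Z p + gf (D X Z) Y p = 0" "gf (D Y Z) X p + gf (D Y X) Z p = 0"
      "gf (D Z X) Y p + gf (D Z Y) X p = 0"
    by (rule *[of _ _ _ s] *[of _ _ _ t] *[of _ _ _ r]; use assms gf_sym[of Z X] in simp)+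
  then show ?thesis
    using assms by (simp add: lie_bracket_eq)
qed

end

section \<open>Pseudo-orthonormal frames\<close>

locale lorentzian_frame = lorentzian_manifold \<A> g D
  for \<A> :: "('m::topological_space, real^3) chart set" and g D +
  fixes e1 e2 e3 :: "'m vfield"
  assumes frame_closed [simp]: "e1 \<in> vector_fields \<A>" "e2 \<in> vector_fields \<A>" "e3 \<in> vector_fields \<A>"
    and orthonormal: "pseudo_orthonormal3 g e1 e2 e3"
begin

lemma gf_frame [simp]:
  "gf e1 e1 = (\<lambda>_. 1)" "gf e2 e2 = (\<lambda>_. 1)" "gf e3 e3 = (\<lambda>_. -1)"
  "gf e1 e2 = (\<lambda>_. 0)" "gf e1 e3 = (\<lambda>_. 0)" "gf e2 e3 = (\<lambda>_. 0)"
  "gf e2 e1 = (\<lambda>_. 0)" "gf e3 e1 = (\<lambda>_. 0)" "gf e3 e2 = (\<lambda>_. 0)"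
  using orthonormal gf_sym[of e2 e1] gf_sym[of e3 e1] gf_sym[of e3 e2]
  by (simp_all add: pseudo_orthonormal3_def fun_eq_iff)

lemma frame_span_at:
  assumes "u \<in> tangent_space \<A> p"
  shows "\<exists>a b c. u = tvec_scale a (vf_at e1 p) + tvec_scale b (vf_at e2 p) + tvec_scale c (vf_at e3 p)"
proof -
  obtain c where c: "c \<in> \<A>" "p \<in> fst c" by (rule chart_at)
  let ?t = "chart_tvec \<A> c p"
  obtain w1 w2 w3 w where w: "vf_at e1 p = ?t w1" "vf_at e2 p = ?t w2" "vf_at e3 p = ?t w3" "u = ?t w"
    using assms vf_at_tangent[of e1 p] vf_at_tangent[of e2 p] vf_at_tangent[of e3 p]
    unfolding tangent_space_eq[OF c] by (auto simp del: frame_closed simp: frame_closed)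
  \<comment> \<open>The frame in chart coordinates: here injectivity implies surjectivity, so the
    coordinate vector of \<open>u\<close> lies in the range.\<close>
  define F :: "real^3 \<Rightarrow> real^3" where "F x = x $ 1 *\<^sub>R w1 + x $ 2 *\<^sub>R w2 + x $ 3 *\<^sub>R w3" for x
  have lin: "linear F"
    by (rule linearI) (simp_all add: F_def algebra_simps)
  have tF: "?t (F x) = tvec_scale (x $ 1) (vf_at e1 p) + tvec_scale (x $ 2) (vf_at e2 p) + tvec_scale (x $ 3) (vf_at e3 p)"
    for x by (simp add: F_def chart_tvec_add[OF c] chart_tvec_scale[OF c] w)
  have frame: "vf_at e1 p \<in> tangent_space \<A> p" "vf_at e2 p \<in> tangent_space \<A> p" "vf_at e3 p \<in> tangent_space \<A> p"
    by (simp_all add: vf_at_tangent)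
  have gF: "g p (?t (F x)) v = x $ 1 * g p (vf_at e1 p) v + x $ 2 * g p (vf_at e2 p) v + x $ 3 * g p (vf_at e3 p) v"
    if "v \<in> tangent_space \<A> p" for x v
    unfolding tF using that frame by (simp add: g_add g_scale tangent_space_add tangent_space_scale)
  have go: "g p (vf_at X p) (vf_at Y p) = gf X Y p" for X Y by (simp add: on_fields_def)
  \<comment> \<open>Orthonormality makes the three tangent vectors independent; they span by dimension.\<close>
  have "inj F"
  proof (rule linear_injective_0[THEN iffD2, OF lin], intro allI impI)
    fix x assume "F x = 0"
    then have "F x = F 0" by (simp add: linear_0[OF lin])
    then have "g p (?t (F x)) v = g p (?t (F 0)) v" for v by simp
    then have "x $ 1 = 0" "x $ 2 = 0" "x $ 3 = 0"
      using gF[OF frame(1), of x] gF[OF frame(2), of x] gF[OF frame(3), of x]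
        gF[OF frame(1), of 0] gF[OF frame(2), of 0] gF[OF frame(3), of 0] by (simp_all add: go)
    then show "x = 0" by (simp add: vec_eq_iff forall_3)
  qed
  then have "surj F" using linear_injective_imp_surjective[OF lin] by simp
  then obtain x where "w = F x" by (meson surjD)
  then show ?thesis using tF[of x] w(4) by blast
qed

text \<open>Pairing the pointwise expansion with the frame identifies its coefficients as smooth
  functions. The minus sign is due to the timelike \<open>e3\<close>.\<close>

lemma frame_expansion:
  assumes "X \<in> VF"
  shows "X = fun_scale (gf X e1) e1 + fun_scale (gf X e2) e2 - fun_scale (gf X e3) e3"
proof -
  have "X f p = (fun_scale (gf X e1) e1 + fun_scale (gf X e2) e2 - fun_scale (gf X e3) e3) f p" for f p
  proof -
    have frame: "vf_at e1 p \<in> tangent_space \<A> p" "vf_at e2 p \<in> tangent_space \<A> p" "vf_at e3 p \<in> tangent_space \<A> p"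
      by (simp_all add: vf_at_tangent)
    obtain a b c where u: "vf_at X p = tvec_scale a (vf_at e1 p) + tvec_scale b (vf_at e2 p) + tvec_scale c (vf_at e3 p)"
      using frame_span_at[OF vf_at_tangent[OF assms]] by blast
    have go: "g p (vf_at X p) (vf_at Y p) = gf X Y p" for X Y by (simp add: on_fields_def)
    have "gf X e1 p = a" "gf X e2 p = b" "gf X e3 p = - c"
      unfolding go[of X, symmetric] u using frame
      by (simp_all add: g_add g_scale tangent_space_add tangent_space_scale go)
    moreover have "X f p = a * e1 f p + b * e2 f p + c * e3 f p"
      using fun_cong[OF u, of f] by (simp add: vf_at_def tvec_scale_def)
    ultimately show ?thesis by (simp add: fun_scale_apply)
  qed
  then show ?thesis by (intro ext)
qed

text \<open>Asking only for additivity and a kernel stable under smooth multiples treats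
  function-valued and field-valued tensors alike.\<close>

lemma frame_vanish:
  fixes T :: "'m vfield \<Rightarrow> 'b::comm_monoid_add"
  assumes "\<And>X Y. X \<in> VF \<Longrightarrow> Y \<in> VF \<Longrightarrow> T (X + Y) = T X + T Y"
    and "\<And>h X. h \<in> C \<Longrightarrow> X \<in> VF \<Longrightarrow> T X = 0 \<Longrightarrow> T (fun_scale h X) = 0"
    and "T e1 = 0" "T e2 = 0" "T e3 = 0" "X \<in> VF"
  shows "T X = 0"
proof -
  \<comment> \<open>The sign moves into the coefficient, since the target of \<open>T\<close> is a
    monoid without subtraction.\<close>
  have "X = fun_scale (gf X e1) e1 + fun_scale (gf X e2) e2 + fun_scale ((\<lambda>_. -1) * gf X e3) e3"
    using frame_expansion[OF assms(6)] by (simp add: fun_scale_def fun_eq_iff)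
  moreover have "T \<dots> = 0"
    using assms by (simp add: smooth_functions_mult)
  ultimately show ?thesis by simp
qed

text \<open>Constant coefficients turn identities between fields into polynomial identities between
  coordinates, which \<open>algebra\<close> decides.\<close>

definition comb :: "real \<Rightarrow> real \<Rightarrow> real \<Rightarrow> 'm vfield" where
  "comb x y z = const_scale x e1 + const_scale y e2 + const_scale z e3"

lemma comb_closed [simp]: "comb x y z \<in> VF"
  by (simp add: comb_def)

lemma frame_comb: "e1 = comb 1 0 0" "e2 = comb 0 1 0" "e3 = comb 0 0 1"
  by (simp_all add: comb_def const_scale_simps)

lemma comb_arith:
  "comb x y z + comb x' y' z' = comb (x + x') (y + y') (z + z')"
  "comb x y z - comb x' y' z' = comb (x - x') (y - y') (z - z')"
  "- comb x y z = comb (- x) (- y) (- z)"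
  "const_scale r (comb x y z) = comb (r * x) (r * y) (r * z)"
  by (simp_all add: comb_def fun_eq_iff const_scale_def fun_scale_def algebra_simps)

lemma comb_cong: "x = x' \<Longrightarrow> y = y' \<Longrightarrow> z = z' \<Longrightarrow> comb x y z = comb x' y' z'"
  by simp

lemma comb_0: "comb 0 0 0 = 0"
  by (simp add: comb_def const_scale_simps)

lemma gf_comb: "gf (comb x y z) (comb x' y' z') = (\<lambda>_. x * x' + y * y' - z * z')"
  by (simp add: comb_def fun_eq_iff)

lemma frame_eqI:
  assumes "X \<in> VF" "Y \<in> VF" "\<And>p. gf X e1 p = gf Y e1 p" "\<And>p. gf X e2 p = gf Y e2 p"
    "\<And>p. gf X e3 p = gf Y e3 p"
  shows "X = Y"
proof -
  have "gf X e1 = gf Y e1" "gf X e2 = gf Y e2" "gf X e3 = gf Y e3"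
    using assms(3-) by auto
  then show ?thesis using frame_expansion[OF assms(1)] frame_expansion[OF assms(2)] by simp
qed

lemma vanish_if_vanish_comb:
  fixes T :: "'m vfield \<Rightarrow> 'b::comm_monoid_add"
  assumes "\<And>X Y. X \<in> VF \<Longrightarrow> Y \<in> VF \<Longrightarrow> T (X + Y) = T X + T Y"
    and "\<And>h X. h \<in> C \<Longrightarrow> X \<in> VF \<Longrightarrow> T X = 0 \<Longrightarrow> T (fun_scale h X) = 0"
    and "\<And>x y z. T (comb x y z) = 0" and "X \<in> VF"
  shows "T X = 0"
  using assms(1,2) assms(3)[of 1 0 0] assms(3)[of 0 1 0] assms(3)[of 0 0 1] assms(4)
  unfolding frame_comb[symmetric] by (rule frame_vanish)

text \<open>The first slot is freed, symmetry exchanges the slots, and the first is freed again;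
  linearity in one slot is enough.\<close>

lemma lie_derivative_vanish:
  assumes V: "V \<in> VF" and "X \<in> VF" "Y \<in> VF"
    and comb: "\<And>x1 x2 x3 y1 y2 y3. lie_derivative V gf (comb x1 x2 x3) (comb y1 y2 y3) = 0"
  shows "lie_derivative V gf X Y = 0"
proof -
  have 1: "lie_derivative V gf X (comb y1 y2 y3) = 0" if "X \<in> VF" for X y1 y2 y3
    by (rule vanish_if_vanish_comb[of "\<lambda>X. lie_derivative V gf X _"]) (use that V comb in simp_all)
  have 2: "lie_derivative V gf (comb x1 x2 x3) Y = 0" for x1 x2 x3
    using 1[OF assms(3)] lie_derivative_sym[OF V _ assms(3)] by simp
  show ?thesis
    by (rule vanish_if_vanish_comb[of "\<lambda>X. lie_derivative V gf X _"]) (use assms 2 in simp_all)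
qed

text \<open>With the sign convention \<open>R(X,Y,Z,W) = -g(R(X,Y)Z,W)\<close>, the constant \<open>l\<close> corresponds to
  sectional curvature \<open>-l\<close>.\<close>

definition curvature_defect :: "real \<Rightarrow> 'm vfield \<Rightarrow> 'm vfield \<Rightarrow> 'm vfield \<Rightarrow> 'm vfield" where
  "curvature_defect l X Y Z =
     curvature D X Y Z - const_scale l (fun_scale (gf X Z) Y - fun_scale (gf Y Z) X)"

lemma curvature_defect_add:
  assumes "X \<in> VF" "Y \<in> VF" "Z \<in> VF" "W \<in> VF"
  shows "curvature_defect l (X + W) Y Z = curvature_defect l X Y Z + curvature_defect l W Y Z"
    and "curvature_defect l X (Y + W) Z = curvature_defect l X Y Z + curvature_defect l X W Z"
    and "curvature_defect l X Y (Z + W) = curvature_defect l X Y Z + curvature_defect l X Y W"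
  using assms by (simp_all add: curvature_defect_def const_scale_def fun_scale_simps)

lemma curvature_defect_scale:
  assumes "X \<in> VF" "Y \<in> VF" "Z \<in> VF" "h \<in> C"
  shows "curvature_defect l (fun_scale h X) Y Z = fun_scale h (curvature_defect l X Y Z)"
    and "curvature_defect l X (fun_scale h Y) Z = fun_scale h (curvature_defect l X Y Z)"
    and "curvature_defect l X Y (fun_scale h Z) = fun_scale h (curvature_defect l X Y Z)"
  using assms
  by (simp_all add: curvature_defect_def const_scale_def fun_scale_simps
      fun_scale_commute[of "\<lambda>_. l" h] fun_scale_commute[of "gf A B" h for A B])

text \<open>The three arguments are freed from constant coefficients one at a time.\<close>

lemma curvature_defect_vanish:
  assumes "X \<in> VF" "Y \<in> VF" "Z \<in> VF"
    and comb: "\<And>x1 x2 x3 y1 y2 y3 z1 z2 z3.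
      curvature_defect l (comb x1 x2 x3) (comb y1 y2 y3) (comb z1 z2 z3) = 0"
  shows "curvature_defect l X Y Z = 0"
proof -
  note tensorial = curvature_defect_add curvature_defect_scale fun_scale_simps
  have 1: "curvature_defect l X (comb y1 y2 y3) (comb z1 z2 z3) = 0" if "X \<in> VF" for X y1 y2 y3 z1 z2 z3
    by (rule vanish_if_vanish_comb[of "\<lambda>X. curvature_defect l X _ _"])
      (use that comb in \<open>simp_all add: tensorial\<close>)
  have 2: "curvature_defect l X Y (comb z1 z2 z3) = 0" if "X \<in> VF" "Y \<in> VF" for X Y z1 z2 z3
    by (rule vanish_if_vanish_comb[of "\<lambda>Y. curvature_defect l X Y _"])
      (use that 1 in \<open>simp_all add: tensorial\<close>)
  show ?thesis
    by (rule vanish_if_vanish_comb[of "\<lambda>Z. curvature_defect l X Y Z"])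
      (use assms(1-3) 2 in \<open>simp_all add: tensorial\<close>)
qed

lemma const_curvature_comb:
  "const_scale l (fun_scale (gf (comb x1 x2 x3) (comb z1 z2 z3)) (comb y1 y2 y3)
     - fun_scale (gf (comb y1 y2 y3) (comb z1 z2 z3)) (comb x1 x2 x3)) =
   comb (l * ((x2 * y1 - x1 * y2) * z2 + (x1 * y3 - x3 * y1) * z3))
     (l * ((x1 * y2 - x2 * y1) * z1 + (x2 * y3 - x3 * y2) * z3))
     (l * ((x1 * y3 - x3 * y1) * z1 + (x2 * y3 - x3 * y2) * z2))"
  \<comment> \<open>The inner products are constant functions, so \<open>fun_scale\<close> folds
    into \<open>const_scale\<close> and everything becomes a single \<open>comb\<close>.\<close>
  unfolding gf_comb const_scale_def[symmetric] comb_arith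
  by (rule comb_cong; algebra)

end

section \<open>The soliton equation on the Lie algebra\<close>

locale unimodular_frame = lorentzian_frame \<A> g D e1 e2 e3
  for \<A> :: "('m::topological_space, real^3) chart set" and g D e1 e2 e3 +
  fixes \<alpha> \<beta> \<gamma> :: real
  assumes bracket12: "lie_bracket e1 e2 = const_scale (- \<gamma>) e3"
    and bracket13: "lie_bracket e1 e3 = const_scale (- \<beta>) e2"
    and bracket23: "lie_bracket e2 e3 = const_scale \<alpha> e1"
begin

text \<open>With \<open>b\<close> and \<open>c\<close> these are the connection coefficients:
  \<open>D e1 e2 = - a e3\<close>, \<open>D e2 e1 = - b e3\<close>, \<open>D e3 e1 = c e2\<close>.
  Torsion-freeness gives back \<alpha> = c - b, \<beta> = a + c, \<gamma> = a - b.\<close>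

definition "a = (\<beta> - \<alpha> + \<gamma>) / 2"
definition "b = (\<beta> - \<alpha> - \<gamma>) / 2"
definition "c = (\<beta> + \<alpha> - \<gamma>) / 2"

lemma brackets:
  "lie_bracket e1 e2 = comb 0 0 (- \<gamma>)" "lie_bracket e1 e3 = comb 0 (- \<beta>) 0" "lie_bracket e2 e3 = comb \<alpha> 0 0"
  "lie_bracket e2 e1 = comb 0 0 \<gamma>" "lie_bracket e3 e1 = comb 0 \<beta> 0" "lie_bracket e3 e2 = comb (- \<alpha>) 0 0"
  "lie_bracket e1 e1 = comb 0 0 0" "lie_bracket e2 e2 = comb 0 0 0" "lie_bracket e3 e3 = comb 0 0 0"
proof -
  show 1: "lie_bracket e1 e2 = comb 0 0 (- \<gamma>)" "lie_bracket e1 e3 = comb 0 (- \<beta>) 0" "lie_bracket e2 e3 = comb \<alpha> 0 0"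
    by (simp_all add: bracket12 bracket13 bracket23 comb_def const_scale_simps)
  have "lie_bracket X Y = - lie_bracket Y X" for X Y :: "'m vfield" by (simp add: lie_bracket_def fun_eq_iff)
  then show "lie_bracket e2 e1 = comb 0 0 \<gamma>" "lie_bracket e3 e1 = comb 0 \<beta> 0" "lie_bracket e3 e2 = comb (- \<alpha>) 0 0"
    using 1 by (metis comb_arith(3) minus_minus minus_zero)+
qed (simp_all add: lie_bracket_eq comb_0)

lemma koszul_frame:
  assumes "X \<in> {e1, e2, e3}" "Y \<in> {e1, e2, e3}" "Z \<in> {e1, e2, e3}"
  shows "gf (D X Y) Z p =
    (gf (lie_bracket X Y) Z p - gf (lie_bracket Y Z) X p + gf (lie_bracket Z X) Y p) / 2"
proof -
  have "X \<in> VF" "Y \<in> VF" "Z \<in> VF" "\<exists>k. gf X Y = (\<lambda>_. k)" "\<exists>k. gf Y Z = (\<lambda>_. k)" "\<exists>k. gf X Z = (\<lambda>_. k)"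
    using assms by fastforce+
  then show ?thesis using koszul_const by blast
qed

lemma gf_comb_frame: "gf (comb x y z) e1 = (\<lambda>_. x)" "gf (comb x y z) e2 = (\<lambda>_. y)" "gf (comb x y z) e3 = (\<lambda>_. - z)"
  by (simp_all add: comb_def fun_eq_iff)

lemma D_frame:
  "D e1 e1 = comb 0 0 0" "D e1 e2 = comb 0 0 (-a)" "D e1 e3 = comb 0 (-a) 0"
  "D e2 e1 = comb 0 0 (-b)" "D e2 e2 = comb 0 0 0" "D e2 e3 = comb (-b) 0 0"
  "D e3 e1 = comb 0 c 0" "D e3 e2 = comb (-c) 0 0" "D e3 e3 = comb 0 0 0"
  by (rule frame_eqI; simp add: koszul_frame brackets gf_comb_frame a_def b_def c_def field_simps)+

lemma D_comb: "D (comb x1 x2 x3) (comb y1 y2 y3) =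
  comb (- b * x2 * y3 - c * x3 * y2) (- a * x1 * y3 + c * x3 * y1) (- a * x1 * y2 - b * x2 * y1)"
  unfolding comb_def[of x1] comb_def[of y1] by (simp add: D_frame comb_arith algebra_simps)

text \<open>Only the 2x2 minors of \<open>X\<close> and \<open>Y\<close> occur, each with one
  coefficient belonging to its plane; this is the shape of \<open>const_curvature_comb\<close>, so
  the two can be compared term by term.\<close>

lemma curvature_comb:
  "curvature D (comb x1 x2 x3) (comb y1 y2 y3) (comb z1 z2 z3) =
   comb
    (- (a * b + a * c - b * c) * (x1 * y2 - x2 * y1) * z2 - (a * b + a * c + b * c) * (x1 * y3 - x3 * y1) * z3)
    ((a * b + a * c - b * c) * (x1 * y2 - x2 * y1) * z1 + (b * c + a * c - a * b) * (x2 * y3 - x3 * y2) * z3)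
    (- (a * b + a * c + b * c) * (x1 * y3 - x3 * y1) * z1 + (b * c + a * c - a * b) * (x2 * y3 - x3 * y2) * z2)"
  unfolding curvature_eq[OF comb_closed comb_closed comb_closed] D_comb comb_arith
  by (rule comb_cong; algebra)

text \<open>The factors are differences of structure constants, so a component of \<open>V\<close>
  is unconstrained by the Killing condition exactly when its two constants coincide.\<close>

lemma lie_derivative_comb:
  "lie_derivative (comb l1 l2 l3) gf (comb x1 x2 x3) (comb y1 y2 y3) = (\<lambda>_.
     (b + c) * l1 * (x2 * y3 + x3 * y2) + (a - c) * l2 * (x1 * y3 + x3 * y1)
      - (a + b) * l3 * (x1 * y2 + x2 * y1))"
  unfolding lie_derivative_eq[OF comb_closed comb_closed comb_closed] D_comb gf_comb fun_eq_iff plus_fun_apply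
  by (intro allI) algebra

lemma soliton_iff:
  "(\<forall>X\<in>VF. \<forall>Y\<in>VF. \<forall>Z\<in>VF. \<forall>W\<in>VF. \<forall>p.
      curvature4 g D X Y Z W p
        + (1/2) * kulkarni_nomizu (lie_derivative (comb l1 l2 l3) gf) gf X Y Z W p
        = (l/2) * kulkarni_nomizu gf gf X Y Z W p)
   \<longleftrightarrow> (b + c) * l1 = 0 \<and> (a - c) * l2 = 0 \<and> (a + b) * l3 = 0 \<and>
     a * b + a * c - b * c = l \<and> a * b + a * c + b * c = - l \<and> b * c + a * c - a * b = l"
  (is "?L \<longleftrightarrow> ?R")
proof
  assume L: ?L
  have "- (gf (curvature D (comb x1 x2 x3) (comb y1 y2 y3) (comb z1 z2 z3)) (comb w1 w2 w3) p)
      + (1/2) * kulkarni_nomizu (lie_derivative (comb l1 l2 l3) gf) gf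
          (comb x1 x2 x3) (comb y1 y2 y3) (comb z1 z2 z3) (comb w1 w2 w3) p
      = (l/2) * kulkarni_nomizu gf gf
          (comb x1 x2 x3) (comb y1 y2 y3) (comb z1 z2 z3) (comb w1 w2 w3) p"
    for x1 x2 x3 y1 y2 y3 z1 z2 z3 w1 w2 w3 p
    using L[rule_format, OF comb_closed comb_closed comb_closed comb_closed]
    unfolding curvature4_def uminus_apply .
  note E = this
  note eval = kulkarni_nomizu_def lie_derivative_comb curvature_comb gf_comb
  \<comment> \<open>With \<open>X = W\<close> one frame field and \<open>Y\<close>, \<open>Z\<close>
    the other two, the curvature and the right side vanish and one off-diagonal entry of the Lie
    derivative is left.\<close>
  have "(b + c) * l1 = 0"
    using E[of 1 0 0 0 1 0 0 0 1 1 0 0] unfolding eval by simp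
  moreover have "(a - c) * l2 = 0"
    using E[of 0 1 0 1 0 0 0 0 1 0 1 0] unfolding eval by simp
  moreover have "(a + b) * l3 = 0"
    using E[of 0 0 1 1 0 0 0 1 0 0 0 1] unfolding eval by simp
  \<comment> \<open>With \<open>X = W\<close> and \<open>Y = Z\<close> two different frame fields,
    the Lie derivative drops out. The right side is \<open>l\<close> times both squared norms, hence
    negative \<open>l\<close> for planes containing \<open>e3\<close>.\<close>
  moreover have "a * b + a * c - b * c = l"
    using E[of 1 0 0 0 1 0 0 1 0 1 0 0] unfolding eval by simp
  moreover have "a * b + a * c + b * c = - l"
    using E[of 1 0 0 0 0 1 0 0 1 1 0 0] unfolding eval by simp
  moreover have "b * c + a * c - a * b = l"
    using E[of 0 1 0 0 0 1 0 0 1 0 1 0] unfolding eval by simp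
  ultimately show ?R by blast
next
  assume R: ?R
  then have z: "(b + c) * l1 = 0" "(a - c) * l2 = 0" "(a + b) * l3 = 0" by blast+
  have "lie_derivative (comb l1 l2 l3) gf (comb x1 x2 x3) (comb y1 y2 y3) = 0" for x1 x2 x3 y1 y2 y3
    unfolding lie_derivative_comb z by (simp add: zero_fun_def)
  then have K: "lie_derivative (comb l1 l2 l3) gf X Y = 0" if "X \<in> VF" "Y \<in> VF" for X Y
    using lie_derivative_vanish[OF comb_closed that] by blast
  have k: "a * b + a * c - b * c = l" "a * b + a * c + b * c = - l" "b * c + a * c - a * b = l"
    using R by blast+
  have "curvature_defect l (comb x1 x2 x3) (comb y1 y2 y3) (comb z1 z2 z3) = 0"
    for x1 x2 x3 y1 y2 y3 z1 z2 z3
    unfolding curvature_defect_def curvature_comb const_curvature_comb k right_minus_eq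
    by (rule comb_cong; algebra)
  then have "curvature_defect l X Y Z = 0" if "X \<in> VF" "Y \<in> VF" "Z \<in> VF" for X Y Z
    using curvature_defect_vanish[OF that] by blast
  then have Q: "curvature D X Y Z = const_scale l (fun_scale (gf X Z) Y - fun_scale (gf Y Z) X)"
    if "X \<in> VF" "Y \<in> VF" "Z \<in> VF" for X Y Z
    using that by (simp add: curvature_defect_def)
  show ?L
  proof (intro ballI allI)
    fix X Y Z W p
    assume VF: "X \<in> VF" "Y \<in> VF" "Z \<in> VF" "W \<in> VF"
    have "curvature4 g D X Y Z W p = - l * (gf X Z p * gf Y W p - gf Y Z p * gf X W p)"
      using VF by (simp add: curvature4_def Q)
    moreover have "kulkarni_nomizu (lie_derivative (comb l1 l2 l3) gf) gf X Y Z W p = 0"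
      using VF by (simp add: kulkarni_nomizu_def K)
    moreover have "kulkarni_nomizu gf gf X Y Z W p = 2 * (gf X W p * gf Y Z p - gf X Z p * gf Y W p)"
      by (simp add: kulkarni_nomizu_def)
    ultimately show "curvature4 g D X Y Z W p
        + (1/2) * kulkarni_nomizu (lie_derivative (comb l1 l2 l3) gf) gf X Y Z W p
        = (l/2) * kulkarni_nomizu gf gf X Y Z W p"
      by (simp only:) (simp add: algebra_simps)
  qed
qed

end

text \<open>The four branches are the solutions of the factored curvature equations; in each, the
  Killing equations decide which components of \<open>V\<close> remain free.\<close>

lemma soliton_parameters:
  fixes a b c :: real
  assumes "\<alpha> = c - b" "\<beta> = a + c" "\<gamma> = a - b"
  shows "(b + c) * l1 = 0 \<and> (a - c) * l2 = 0 \<and> (a + b) * l3 = 0 \<and>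
     a * b + a * c - b * c = l \<and> a * b + a * c + b * c = - l \<and> b * c + a * c - a * b = l \<longleftrightarrow>
      (\<beta> = \<gamma> \<and> \<alpha> \<noteq> \<gamma> \<and> l2 = 0 \<and> l3 = 0 \<and> \<alpha> = 0 \<and> l = 0)
    \<or> (\<alpha> = \<beta> \<and> \<beta> = \<gamma> \<and> l = 1/4 * \<alpha>^2)
    \<or> (\<beta> \<noteq> \<gamma> \<and> \<alpha> = \<beta> \<and> l1 = 0 \<and> l2 = 0 \<and> \<gamma> = 0 \<and> l = 0)
    \<or> (\<beta> \<noteq> \<gamma> \<and> \<alpha> = \<gamma> \<and> l1 = 0 \<and> l3 = 0 \<and> \<beta> = 0 \<and> l = 0)" (is "?L \<longleftrightarrow> ?R")
proof
  assume L: ?L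
  \<comment> \<open>Sums and differences of pairs of curvature equations eliminate
    \<open>l\<close>.\<close>
  then have "a * b + a * c = 0" "a * b - b * c = 0" "a * c + b * c = 0" by linarith+
  then have "a * (b + c) = 0" "b * (a - c) = 0" "c * (a + b) = 0" by algebra+
  then consider "a = 0" "b = 0" | "a = 0" "c = 0" | "b = 0" "c = 0" | "b = - a" "c = a"
    by fastforce
  then show ?R
  proof cases
    case 1
    \<comment> \<open>If the third coefficient vanishes too, all structure constants are 0 and the
      point belongs to the case \<alpha> = \<beta> = \<gamma>. Otherwise the Killing equations kill
      two components of \<open>V\<close>. The next two branches are alike.\<close>
    then show ?thesis using L by (cases "c = 0") (simp_all add: assms)
  next
    case 2
    then show ?thesis using L by (cases "b = 0") (simp_all add: assms)
  next
    case 3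
    then show ?thesis using L by (cases "a = 0") (simp_all add: assms)
  next
    case 4
    then show ?thesis using L by (simp add: assms power2_eq_square)
  qed
next
  assume ?R
  then consider "b = 0" "c = 0" "l2 = 0" "l3 = 0" "l = 0" | "b = - a" "c = a" "l = 1/4 * \<alpha>^2"
    | "a = 0" "b = 0" "l1 = 0" "l2 = 0" "l = 0" | "a = 0" "c = 0" "l1 = 0" "l3 = 0" "l = 0"
    using assms by (elim disjE conjE) (simp; linarith)+
  then show ?L
    by cases (simp_all add: assms power2_eq_square)
qed

theorem theorem2p3:
  fixes G :: "'m::{t2_space, second_countable_topology} monoid"
    and \<A> :: "('m, real^3) chart set"
    and g :: "'m metric"
    and D :: "'m connection"
    and e1 e2 e3 V :: "'m vfield"
    and \<alpha> \<beta> \<gamma> l1 l2 l3 l :: real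
  assumes "lie_group G \<A>"
    and "connected (UNIV :: 'm set)"
    and "simply_connected (UNIV :: 'm set)"
    and "lorentzian_metric \<A> g"
    and "left_invariant_metric G \<A> g"
    and "levi_civita \<A> g D"
    and "lie_algebra_basis3 G \<A> e1 e2 e3"
    and "pseudo_orthonormal3 g e1 e2 e3"
    and "lie_bracket e1 e2 = const_scale (- \<gamma>) e3"
    and "lie_bracket e1 e3 = const_scale (- \<beta>) e2"
    and "lie_bracket e2 e3 = const_scale \<alpha> e1"
    and "V = const_scale l1 e1 + const_scale l2 e2 + const_scale l3 e3"
  shows "left_invariant_riemann_soliton G \<A> g D V l \<longleftrightarrow>
      (\<beta> = \<gamma> \<and> \<alpha> \<noteq> \<gamma> \<and> l2 = 0 \<and> l3 = 0 \<and> \<alpha> = 0 \<and> l = 0)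
    \<or> (\<alpha> = \<beta> \<and> \<beta> = \<gamma> \<and> l = 1/4 * \<alpha>^2)
    \<or> (\<beta> \<noteq> \<gamma> \<and> \<alpha> = \<beta> \<and> l1 = 0 \<and> l2 = 0 \<and> \<gamma> = 0 \<and> l = 0)
    \<or> (\<beta> \<noteq> \<gamma> \<and> \<alpha> = \<gamma> \<and> l1 = 0 \<and> l3 = 0 \<and> \<beta> = 0 \<and> l = 0)"
proof -
  have e: "e1 \<in> lie_algebra G \<A>" "e2 \<in> lie_algebra G \<A>" "e3 \<in> lie_algebra G \<A>"
    using assms(7) by (simp_all add: lie_algebra_basis3_def)
  interpret unimodular_frame \<A> g D e1 e2 e3 \<alpha> \<beta> \<gamma>
    using assms e by unfold_locales (simp_all add: lie_group.atlas lie_algebra_def)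
  have V: "V = comb l1 l2 l3" by (simp add: assms(12) comb_def)
  have "V \<in> lie_algebra G \<A>"
    by (simp add: assms(12) e lie_algebra_add lie_algebra_const_scale)
  then have "left_invariant_riemann_soliton G \<A> g D V l \<longleftrightarrow>
     (b + c) * l1 = 0 \<and> (a - c) * l2 = 0 \<and> (a + b) * l3 = 0 \<and>
     a * b + a * c - b * c = l \<and> a * b + a * c + b * c = - l \<and> b * c + a * c - a * b = l"
    unfolding left_invariant_riemann_soliton_def soliton_iff[symmetric] V by simp
  also have "\<dots> \<longleftrightarrow>
      (\<beta> = \<gamma> \<and> \<alpha> \<noteq> \<gamma> \<and> l2 = 0 \<and> l3 = 0 \<and> \<alpha> = 0 \<and> l = 0)
    \<or> (\<alpha> = \<beta> \<and> \<beta> = \<gamma> \<and> l = 1/4 * \<alpha>^2)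
    \<or> (\<beta> \<noteq> \<gamma> \<and> \<alpha> = \<beta> \<and> l1 = 0 \<and> l2 = 0 \<and> \<gamma> = 0 \<and> l = 0)
    \<or> (\<beta> \<noteq> \<gamma> \<and> \<alpha> = \<gamma> \<and> l1 = 0 \<and> l3 = 0 \<and> \<beta> = 0 \<and> l = 0)"
    by (rule soliton_parameters) (simp_all add: a_def b_def c_def field_simps)
  finally show ?thesis .
qed

end
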